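(* Let $s\ge0$ be an integer, $h\in\mathbb C\setminus\{0\}$ and $q\in\mathbb C\setminus\{0\}$. For all integers $n,k\ge1$, $$S_{s,h,q}[n,k]=\sum_{r=k-1}^{n-1}h^{n-r-1}q^r\genfrac{[}{]}{0pt}{}{n-1}{r}_{q^s}S_{s,h,q}[r,k-1]\prod_{i=0}^{n-r-2}[1+si]_q .$$ Furthermore, for all $n\ge1$, $$B_{s,h,q}[n]=\sum_{r=0}^{n-1}h^{n-r-1}q^r\genfrac{[}{]}{0pt}{}{n-1}{r}_{q^s}B_{s,h,q}[r]\prod_{i=0}^{n-r-2}[1+si]_q .$$
   Context: For an integer $x$, $[x]_q=\frac{q^x-1}{q-1}$ if $q\ne1$ and $[x]_1=x$. $\genfrac{[}{]}{0pt}{}{n}{k}_p$ is the Gaussian ($p$-binomial) coefficient, understood as a polynomial in $p$ evaluated at the given value. The numbers $S_{s,h,q}[n,k]$ are the coefficients in $(VU)^n=\sum_{k=0}^nS_{s,h,q}[n,k]V^{sn-(s-1)k}U^k$, where $UV-qVU=hV^s$; equivalently they are determined by $S_{s,h,q}[n,k]=q^{s(n-1)-(s-1)(k-1)}S_{s,h,q}[n-1,k-1]+h[s(n-1)-(s-1)k]_q\,S_{s,h,q}[n-1,k]$ for $n,k\ge1$, with $S_{s,h,q}[n,0]=S_{s,h,q}[0,n]=\delta_{0,n}$. The generalized $q$-Bell numbers are $B_{s,h,q}[n]=\sum_{k=0}^nS_{s,h,q}[n,k]$. Empty products equal $1$, empty sums equal $0$. *)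

theory Defs
  imports Complex_Main "HOL-Computational_Algebra.Polynomial"
begin

definition q_bracket :: "complex \<Rightarrow> int \<Rightarrow> complex" where
  "q_bracket q x = (if q = 1 then of_int x else (q powi x - 1) / (q - 1))"

text \<open>
  The Gaussian coefficient is the quotient of \<open>\<Prod>i<k. X ^ (n - i) - 1\<close> by
  \<open>\<Prod>i<k. X ^ (i + 1) - 1\<close>. The division takes place between polynomials, where it is exact
  (\<open>gauss_poly_mult_den\<close> below), so that evaluation makes sense at roots of unity as well.
  For \<open>k > n\<close> the numerator has the factor \<open>X ^ 0 - 1 = 0\<close>.
\<close>

definition gauss_num :: "nat \<Rightarrow> nat \<Rightarrow> complex poly" where
  "gauss_num n k = (\<Prod>i<k. monom 1 (n - i) - 1)"

definition gauss_den :: "nat \<Rightarrow> complex poly" where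
  "gauss_den k = (\<Prod>i<k. monom 1 (i + 1) - 1)"

definition gauss_poly :: "nat \<Rightarrow> nat \<Rightarrow> complex poly" where
  "gauss_poly n k = gauss_num n k div gauss_den k"

definition gauss_binomial :: "complex \<Rightarrow> nat \<Rightarrow> nat \<Rightarrow> complex" where
  "gauss_binomial p n k = poly (gauss_poly n k) p"

text \<open>
  The recursion with \<open>n\<close> and \<open>k\<close> shifted by one; that these numbers are
  the normal ordering coefficients is \<open>normal_ordering\<close> below.
\<close>

fun gen_stirling :: "nat \<Rightarrow> complex \<Rightarrow> complex \<Rightarrow> nat \<Rightarrow> nat \<Rightarrow> complex" where
  "gen_stirling s h q 0 0 = 1"
| "gen_stirling s h q 0 (Suc k) = 0"
| "gen_stirling s h q (Suc n) 0 = 0"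
| "gen_stirling s h q (Suc n) (Suc k) =
     q powi (int s * int n - (int s - 1) * int k) * gen_stirling s h q n k
     + h * q_bracket q (int s * int n - (int s - 1) * int (Suc k)) * gen_stirling s h q n (Suc k)"

definition gen_bell :: "nat \<Rightarrow> complex \<Rightarrow> complex \<Rightarrow> nat \<Rightarrow> complex" where
  "gen_bell s h q n = (\<Sum>k\<le>n. gen_stirling s h q n k)"


lemma gauss_den_nonzero: "gauss_den k \<noteq> 0"
proof -
  have "monom (1::complex) (i + 1) - 1 \<noteq> 0" for i
  proof
    assume "monom (1::complex) (i + 1) - 1 = 0"
    then have "coeff (monom (1::complex) (i + 1) - 1) (i + 1) = 0" by (metis coeff_0)
    then show False by simp
  qed
  then show ?thesis by (simp add: gauss_den_def)
qed

lemma gauss_num_eq_0: "n < k \<Longrightarrow> gauss_num n k = 0"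
  unfolding gauss_num_def by (rule prod_zero) (auto intro!: bexI[of _ n] simp: monom_0 one_pCons)

lemma gauss_num_Suc_Suc:
  "gauss_num (Suc n) (Suc k) =
     monom 1 (Suc k) * gauss_num n (Suc k) + (monom 1 (Suc k) - 1) * gauss_num n k"
proof (cases "k \<le> n")
  case True
  have *: "gauss_num (Suc n) (Suc k) = (monom 1 (Suc n) - 1) * gauss_num n k"
    unfolding gauss_num_def by (subst prod.lessThan_Suc_shift) simp
  have **: "gauss_num n (Suc k) = gauss_num n k * (monom 1 (n - k) - 1)"
    by (simp add: gauss_num_def)
  have m: "monom (1::complex) (Suc n) = monom 1 (Suc k) * monom 1 (n - k)"
    using True by (simp add: mult_monom)
  show ?thesis unfolding * ** m by (simp add: algebra_simps)
next
  case False
  then show ?thesis by (simp add: gauss_num_eq_0)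
qed

lemma gauss_den_dvd_num: "gauss_den k dvd gauss_num n k"
proof (induction n arbitrary: k)
  case 0
  then show ?case by (cases k) (simp_all add: gauss_num_eq_0 gauss_den_def)
next
  case (Suc n)
  show ?case
  proof (cases k)
    case 0
    then show ?thesis by (simp add: gauss_den_def)
  next
    case (Suc j)
    have "gauss_den (Suc j) = (monom 1 (Suc j) - 1) * gauss_den j"
      by (simp add: gauss_den_def)
    then have "gauss_den (Suc j) dvd (monom 1 (Suc j) - 1) * gauss_num n j"
      using Suc.IH[of j] by (simp add: mult_dvd_mono)
    then show ?thesis
      unfolding Suc gauss_num_Suc_Suc using Suc.IH[of "Suc j"] by (simp only: dvd_add dvd_mult)
  qed
qed

lemma gauss_poly_mult_den: "gauss_poly n k * gauss_den k = gauss_num n k"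
  using gauss_den_dvd_num by (simp add: gauss_poly_def)

lemma q_bracket_Suc: "q_bracket q (int (Suc a)) = q_bracket q (int a) + q ^ a"
proof (cases "q = 1")
  case False
  then show ?thesis unfolding q_bracket_def power_int_of_nat by (simp add: field_simps)
qed (simp add: q_bracket_def)

lemma gen_stirling_eq_0: "n < k \<Longrightarrow> gen_stirling s h q n k = 0"
proof (induction n arbitrary: k)
  case 0
  then show ?case by (cases k) auto
next
  case (Suc n)
  then show ?case by (cases k) auto
qed

text \<open>
  Here \<open>c\<close> embeds the scalars into the centre of an algebra, and for \<open>k \<le> n\<close>
  the exponent \<open>s * n - (s - 1) * k\<close> is the natural number \<open>s * (n - k) + k\<close>.
\<close>

lemma normal_ordering:
  fixes U V :: "'a::ring_1" and c :: "complex \<Rightarrow> 'a"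
  assumes c_1: "c 1 = 1"
    and c_add: "\<And>x y. c (x + y) = c x + c y"
    and c_mult: "\<And>x y. c (x * y) = c x * c y"
    and c_central: "\<And>x a. c x * a = a * c x"
    and rel: "U * V - c q * V * U = c h * V ^ s"
  shows "(V * U) ^ n = (\<Sum>k\<le>n. c (gen_stirling s h q n k) * V ^ (s * (n - k) + k) * U ^ k)"
proof -
  have c_0: "c 0 = 0" using c_add[of 0 0] by simp
  have UV: "U * V = c q * V * U + c h * V ^ s" using rel by (simp add: algebra_simps)
  have step: "V * U * V ^ a = c (q ^ a) * V ^ Suc a * U + c (h * q_bracket q (int a)) * V ^ (a + s)" for a
  proof (induction a)
    case 0
    then show ?case by (simp add: c_1 c_0 q_bracket_def)
  next
    case (Suc a)
    have "V * U * V ^ Suc a = (V * U * V ^ a) * V"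
      by (simp only: power_Suc2 mult.assoc)
    also have "\<dots> = c (q ^ a) * V ^ Suc a * (U * V) + c (h * q_bracket q (int a)) * V ^ (a + s) * V"
      unfolding Suc.IH by (simp only: distrib_right mult.assoc)
    also have "c (q ^ a) * V ^ Suc a * (U * V)
        = c (q ^ a) * (V ^ Suc a * c q) * V * U + c (q ^ a) * (V ^ Suc a * c h) * V ^ s"
      unfolding UV by (simp only: distrib_left mult.assoc)
    also have "\<dots> = c (q ^ a * q) * (V ^ Suc a * V) * U + c (q ^ a * h) * (V ^ Suc a * V ^ s)"
      by (simp only: c_central[symmetric, of "V ^ Suc a"] c_mult mult.assoc)
    also have "c (h * q_bracket q (int a)) * V ^ (a + s) * V = c (h * q_bracket q (int a)) * V ^ (Suc a + s)"
      by (simp only: mult.assoc power_Suc2[symmetric] add_Suc)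
    finally show ?case
      unfolding q_bracket_Suc
      by (simp only: power_Suc2[symmetric] power_add[symmetric] distrib_left distrib_right c_add
            mult.commute[of h] ac_simps(1))
        (simp only: add.assoc add.commute add.left_commute)
  qed
  define e where "e n k = s * (n - k) + k" for n k :: nat
  have e: "int (e n k) = int s * int n - (int s - 1) * int k" if "k \<le> n" for n k
  proof -
    have "int (n - k) = int n - int k" using that by (rule of_nat_diff)
    then show ?thesis unfolding e_def of_nat_add of_nat_mult by (simp add: algebra_simps)
  qed
  have "(V * U) ^ n = (\<Sum>k\<le>n. c (gen_stirling s h q n k) * V ^ e n k * U ^ k)"
  proof (induction n)
    case 0
    then show ?case by (simp add: c_1 e_def)
  next
    case (Suc n)
    let ?S = "gen_stirling s h q"
    define A where "A k = c (?S n k * q ^ e n k) * V ^ Suc (e n k) * U ^ Suc k" for k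
    define B where "B k = c (?S n k * (h * q_bracket q (int (e n k)))) * V ^ (e n k + s) * U ^ k" for k
    have "(V * U) ^ Suc n = (\<Sum>k\<le>n. (V * U) * (c (?S n k) * V ^ e n k * U ^ k))"
      unfolding power_Suc Suc.IH by (rule sum_distrib_left)
    also have "\<dots> = (\<Sum>k\<le>n. A k + B k)"
    proof (rule sum.cong)
      fix k
      have "(V * U) * (c (?S n k) * V ^ e n k * U ^ k) = ((V * U) * c (?S n k)) * V ^ e n k * U ^ k"
        by (simp only: mult.assoc)
      also have "\<dots> = c (?S n k) * (V * U * V ^ e n k) * U ^ k"
        by (simp only: c_central[symmetric] mult.assoc)
      also have "\<dots> = A k + B k"
        unfolding step A_def B_def by (simp only: distrib_left distrib_right c_mult mult.assoc power_Suc)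
      finally show "(V * U) * (c (?S n k) * V ^ e n k * U ^ k) = A k + B k" .
    qed simp
    also have "\<dots> = (\<Sum>k\<le>n. A k) + (\<Sum>k\<le>n. B k)" by (rule sum.distrib)
    also have "(\<Sum>k\<le>n. B k) = B 0 + (\<Sum>k<n. B (Suc k))"
      by (rule sum.atMost_shift)
    also have "(\<Sum>k<n. B (Suc k)) = (\<Sum>k\<le>n. B (Suc k))"
      by (simp add: lessThan_Suc_atMost[symmetric] B_def gen_stirling_eq_0 c_0)
    also have "B 0 = 0"
      by (cases n) (simp_all add: B_def e_def q_bracket_def c_0)
    finally have 1: "(V * U) ^ Suc n = (\<Sum>k\<le>n. A k + B (Suc k))"
      by (simp add: sum.distrib)
    have 2: "A k + B (Suc k) = c (?S (Suc n) (Suc k)) * V ^ e (Suc n) (Suc k) * U ^ Suc k"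
      if k: "k \<le> n" for k
    proof -
      have A': "A k = c (q powi (int s * int n - (int s - 1) * int k) * ?S n k) * V ^ e (Suc n) (Suc k) * U ^ Suc k"
        unfolding A_def e[OF k, symmetric] power_int_of_nat by (simp add: e_def mult.commute)
      have B': "B (Suc k) = c (h * q_bracket q (int s * int n - (int s - 1) * int (Suc k)) * ?S n (Suc k))
          * V ^ e (Suc n) (Suc k) * U ^ Suc k"
      proof (cases "k = n")
        case True
        then show ?thesis by (simp add: B_def gen_stirling_eq_0 c_0)
      next
        case False
        then have k': "Suc k \<le> n" using k by simp
        have *: "e n (Suc k) + s = e (Suc n) (Suc k)"
        proof -
          have "n - k = Suc (n - Suc k)" using k' by simp
          then show ?thesis by (simp add: e_def)
        qed
        show ?thesis
          unfolding B_def e[OF k', symmetric] * by (simp only: mult.commute[of "?S n (Suc k)"])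
      qed
      show ?thesis unfolding A' B' by (simp only: gen_stirling.simps c_add distrib_right)
    qed
    have "(\<Sum>k\<le>Suc n. c (?S (Suc n) k) * V ^ e (Suc n) k * U ^ k)
        = (\<Sum>k\<le>n. c (?S (Suc n) (Suc k)) * V ^ e (Suc n) (Suc k) * U ^ Suc k)"
      by (subst sum.atMost_Suc_shift) (simp add: c_0)
    also have "\<dots> = (\<Sum>k\<le>n. A k + B (Suc k))"
      by (intro sum.cong refl 2[symmetric]) (rule atMost_iff[THEN iffD1])
    finally show ?case unfolding 1 by (rule sym)
  qed
  then show ?thesis by (simp add: e_def)
qed

end

theory Submission
  imports Defs
begin

text \<open>
  With \<open>X = V U\<close> and \<open>Y = V ^ s\<close> one has
  \<open>(V U) ^ Suc n = V (U V) ^ n U = V (q X + h Y) ^ n U\<close>, and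
  \<open>(q X + h Y) Y ^ j X ^ r = q ^ (1 + s j) Y ^ j X ^ (r + 1) + h [1 + s j] Y ^ (j + 1) X ^ r\<close>.
  Hence \<open>(q X + h Y) ^ n = (\<Sum>r\<le>n. w n r Y ^ (n - r) X ^ r)\<close>, where the Pascal rule identifies
  \<open>w n r\<close> as the weight in the theorem. The proof runs the same computation on coefficients,
  by induction on \<open>n\<close>.
\<close>

text \<open>The second Pascal rule, with the power of \<open>X\<close> on the other term. It comes
  from splitting \<open>X^(n+1) - 1\<close> as
  \<open>(X^(n-k) - 1) + X^(n-k) (X^(k+1) - 1)\<close>.\<close>

lemma gauss_num_Suc_Suc':
  assumes "k \<le> n"
  shows "gauss_num (Suc n) (Suc k) =
    gauss_num n (Suc k) + monom 1 (n - k) * (monom 1 (Suc k) - 1) * gauss_num n k"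
proof -
  have 1: "gauss_num (Suc n) (Suc k) = (monom 1 (Suc n) - 1) * gauss_num n k"
    unfolding gauss_num_def by (subst prod.lessThan_Suc_shift) simp
  have 2: "gauss_num n (Suc k) = gauss_num n k * (monom 1 (n - k) - 1)"
    by (simp add: gauss_num_def)
  have 3: "monom (1::complex) (Suc n) = monom 1 (n - k) * monom 1 (Suc k)"
    using assms by (simp add: mult_monom)
  show ?thesis unfolding 1 2 3 by (simp add: algebra_simps)
qed

text \<open>Cancelling the nonzero polynomial \<open>gauss_den (Suc k)\<close> before evaluation
  keeps the rule valid at roots of unity.\<close>

lemma gauss_poly_Suc_Suc':
  assumes "k \<le> n"
  shows "gauss_poly (Suc n) (Suc k) = gauss_poly n (Suc k) + monom 1 (n - k) * gauss_poly n k"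
proof -
  have den: "gauss_den (Suc k) = (monom 1 (Suc k) - 1) * gauss_den k"
    by (simp add: gauss_den_def)
  have "gauss_poly (Suc n) (Suc k) * gauss_den (Suc k)
      = gauss_num n (Suc k) + monom 1 (n - k) * (monom 1 (Suc k) - 1) * gauss_num n k"
    by (simp only: gauss_poly_mult_den gauss_num_Suc_Suc'[OF assms])
  also have "\<dots> = gauss_poly n (Suc k) * gauss_den (Suc k)
      + monom 1 (n - k) * (monom 1 (Suc k) - 1) * (gauss_poly n k * gauss_den k)"
    by (simp only: gauss_poly_mult_den)
  also have "\<dots> = (gauss_poly n (Suc k) + monom 1 (n - k) * gauss_poly n k) * gauss_den (Suc k)"
    unfolding den by (simp only: distrib_left distrib_right ac_simps)
  finally show ?thesis using gauss_den_nonzero by (simp only: mult_cancel_right) blast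
qed

lemma gauss_binomial_Suc_Suc':
  "k \<le> n \<Longrightarrow>
    gauss_binomial p (Suc n) (Suc k) = gauss_binomial p n (Suc k) + p ^ (n - k) * gauss_binomial p n k"
  by (simp add: gauss_binomial_def gauss_poly_Suc_Suc' poly_monom)

lemma gauss_binomial_0 [simp]: "gauss_binomial p n 0 = 1"
  by (simp add: gauss_binomial_def gauss_poly_def gauss_num_def gauss_den_def)

lemma gauss_binomial_eq_0: "n < k \<Longrightarrow> gauss_binomial p n k = 0"
  by (simp add: gauss_binomial_def gauss_poly_def gauss_num_eq_0)

text \<open>Integer arguments matter: for \<open>s \<ge> 2\<close> the value
  \<open>s r - (s - 1) k\<close> is negative once \<open>k\<close> is large compared with
  \<open>r\<close>.\<close>

lemma q_bracket_add:
  assumes "q \<noteq> 0"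
  shows "q_bracket q (x + y) = q_bracket q x + q powi x * q_bracket q y"
proof (cases "q = 1")
  case False
  then have "q - 1 \<noteq> 0" by simp
  then show ?thesis using False assms
    by (simp add: q_bracket_def power_int_add divide_simps) (simp add: algebra_simps)
qed (simp add: q_bracket_def)

definition recurrence_weight :: "nat \<Rightarrow> complex \<Rightarrow> complex \<Rightarrow> nat \<Rightarrow> nat \<Rightarrow> complex" where
  "recurrence_weight s h q n r = h ^ (n - r) * q ^ r * gauss_binomial (q ^ s) n r
     * (\<Prod>i<n - r. q_bracket q (1 + int s * int i))"

text \<open>Left multiplication of \<open>(q X + h Y) ^ n\<close> by one more factor, with an
  arbitrary \<open>f r\<close> in place of \<open>X ^ r\<close> and the powers of \<open>Y\<close>
  dropped.\<close>

lemma sum_recurrence_weight_Suc: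
  "(\<Sum>r\<le>Suc n. recurrence_weight s h q (Suc n) r * f r) =
    (\<Sum>r\<le>n. recurrence_weight s h q n r *
      (q ^ (1 + s * (n - r)) * f (Suc r) + h * q_bracket q (1 + int s * int (n - r)) * f r))"
proof -
  let ?w = "recurrence_weight s h q"
  \<comment> \<open>The Pascal rule splits the weight at \<open>Suc n\<close>: \<open>v\<close>
    carries the term without a power of \<open>q ^ s\<close>, the rest is a shifted multiple of the
    weight at \<open>n\<close>.\<close>
  define v where "v r = h ^ (Suc n - r) * q ^ r * gauss_binomial (q ^ s) n r
     * (\<Prod>i<Suc n - r. q_bracket q (1 + int s * int i))" for r
  have w0: "?w (Suc n) 0 = v 0"
    by (simp add: recurrence_weight_def v_def)
  have w: "?w (Suc n) (Suc r) = q ^ (1 + s * (n - r)) * ?w n r + v (Suc r)" if "r \<le> n" for r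
    using that by (simp add: recurrence_weight_def v_def gauss_binomial_Suc_Suc'
      power_mult distrib_left distrib_right)
  have v: "v r = ?w n r * (h * q_bracket q (1 + int s * int (n - r)))" if "r \<le> n" for r
    using that by (simp add: recurrence_weight_def v_def Suc_diff_le)
  have "(\<Sum>r\<le>Suc n. ?w (Suc n) r * f r) =
      v 0 * f 0 + (\<Sum>r\<le>n. ?w (Suc n) (Suc r) * f (Suc r))"
    by (simp only: sum.atMost_Suc_shift w0)
  also have "(\<Sum>r\<le>n. ?w (Suc n) (Suc r) * f (Suc r)) =
      (\<Sum>r\<le>n. q ^ (1 + s * (n - r)) * ?w n r * f (Suc r)) + (\<Sum>r\<le>n. v (Suc r) * f (Suc r))"
    unfolding sum.distrib[symmetric]
    by (rule sum.cong[OF refl]) (simp only: w atMost_iff distrib_right)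
  also have "v 0 * f 0 + (\<dots>) =
      (\<Sum>r\<le>n. q ^ (1 + s * (n - r)) * ?w n r * f (Suc r)) + (\<Sum>r\<le>Suc n. v r * f r)"
    by (simp only: sum.atMost_Suc_shift add.left_commute)
  also have "(\<Sum>r\<le>Suc n. v r * f r) = (\<Sum>r\<le>n. v r * f r)"
    by (simp add: v_def gauss_binomial_eq_0)
  finally show ?thesis
    unfolding sum.distrib[symmetric]
    by (elim trans, intro sum.cong refl) (simp add: v distrib_left ac_simps)
qed

text \<open>Extends the recursion to column 0: the bracket vanishes for \<open>n = 0\<close>, the
  Stirling number for \<open>n > 0\<close>.\<close>

lemma gen_stirling_Suc_0: "gen_stirling s h q (Suc n) 0 = h * q_bracket q (int s * int n) * gen_stirling s h q n 0"
  by (cases n) (simp_all add: q_bracket_def)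

lemma gen_stirling_Suc_Suc:
  assumes "q \<noteq> 0"
  shows "gen_stirling s h q (Suc n) (Suc k) =
    (\<Sum>r\<le>n. recurrence_weight s h q n r * gen_stirling s h q r k)"
proof (induction n arbitrary: k)
  case 0
  show ?case by (cases k) (simp_all add: recurrence_weight_def q_bracket_def)
next
  case (Suc n)
  let ?S = "gen_stirling s h q" and ?w = "recurrence_weight s h q"
  define e where "e n k = int s * int n - (int s - 1) * int k" for n k :: nat
  \<comment> \<open>\<open>P k r\<close> is the entry in column \<open>k - 1\<close>, set to 0 for
    \<open>k = 0\<close>, so that \<open>rec\<close> and \<open>IH\<close> need no case distinction
    on \<open>k\<close>.\<close>
  define P where "P k = (case k of 0 \<Rightarrow> \<lambda>_. 0 | Suc j \<Rightarrow> \<lambda>r. ?S r j)" for k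
  have rec: "?S (Suc r) k = q powi (e r k + (int s - 1)) * P k r + h * q_bracket q (e r k) * ?S r k" for r
    by (cases k) (simp_all add: P_def e_def gen_stirling_Suc_0 algebra_simps del: gen_stirling.simps(3))
  have IH: "?S (Suc n) k = (\<Sum>r\<le>n. ?w n r * P k r)"
    by (cases k) (simp_all add: P_def Suc.IH del: gen_stirling.simps(4))
  \<comment> \<open>Expanding \<open>?S (Suc r) k\<close> by \<open>rec\<close> and merging brackets
    by \<open>[d] + q^d [e] = [d + e]\<close> leaves coefficients free of \<open>r\<close>, which
    can leave the sum.\<close>
  have step: "q ^ (1 + s * (n - r)) * ?S (Suc r) k + h * q_bracket q (1 + int s * int (n - r)) * ?S r k
      = q powi e (Suc n) k * P k r + h * q_bracket q (e (Suc n) (Suc k)) * ?S r k"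
    if "r \<le> n" for r
  proof -
    define d where "d = 1 + int s * int (n - r)"
    have d: "q ^ (1 + s * (n - r)) = q powi d"
      unfolding d_def using power_int_of_nat[of q "1 + s * (n - r)"] by simp
    have e1: "e (Suc n) k = d + (e r k + (int s - 1))" and e2: "e (Suc n) (Suc k) = d + e r k"
      using that by (simp_all add: d_def e_def of_nat_diff algebra_simps)
    have p: "q powi (d + (e r k + (int s - 1))) = q powi d * q powi (e r k + (int s - 1))"
      using assms by (simp add: power_int_add)
    show ?thesis
      unfolding d d_def[symmetric] rec e1 e2 p q_bracket_add[OF assms]
      by (simp add: algebra_simps)
  qed
  have "(\<Sum>r\<le>Suc n. ?w (Suc n) r * ?S r k) =
      (\<Sum>r\<le>n. ?w n r * (q powi e (Suc n) k * P k r + h * q_bracket q (e (Suc n) (Suc k)) * ?S r k))"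
    unfolding sum_recurrence_weight_Suc by (intro sum.cong refl) (simp only: step atMost_iff)
  \<comment> \<open>The induction hypothesis is used in two columns, \<open>k - 1\<close> (through
    \<open>IH\<close>) and \<open>k\<close>; hence the induction with \<open>k\<close>
    arbitrary.\<close>
  also have "\<dots> = q powi e (Suc n) k * ?S (Suc n) k
      + h * q_bracket q (e (Suc n) (Suc k)) * ?S (Suc n) (Suc k)"
    unfolding IH Suc.IH[of k]
    by (simp add: sum_distrib_left sum.distrib distrib_left ac_simps)
  also have "\<dots> = ?S (Suc (Suc n)) (Suc k)"
    by (simp only: gen_stirling.simps(4) e_def)
  finally show ?case by (rule sym)
qed

lemma gen_bell_Suc:
  assumes "q \<noteq> 0"
  shows "gen_bell s h q (Suc n) = (\<Sum>r\<le>n. recurrence_weight s h q n r * gen_bell s h q r)"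
proof -
  let ?S = "gen_stirling s h q" and ?w = "recurrence_weight s h q"
  \<comment> \<open>Padding with zeros gives all inner sums the same range, so the two summations
    can be exchanged.\<close>
  have bell: "gen_bell s h q r = (\<Sum>k\<le>n. ?S r k)" if "r \<le> n" for r
    unfolding gen_bell_def using that
    by (intro sum.mono_neutral_left) (auto simp: gen_stirling_eq_0)
  have "gen_bell s h q (Suc n) = (\<Sum>k\<le>n. ?S (Suc n) (Suc k))"
    unfolding gen_bell_def by (subst sum.atMost_Suc_shift) simp
  also have "\<dots> = (\<Sum>r\<le>n. \<Sum>k\<le>n. ?w n r * ?S r k)"
    unfolding gen_stirling_Suc_Suc[OF assms] by (rule sum.swap)
  finally show ?thesis by (simp add: bell sum_distrib_left)
qed

theorem theorem16:
  fixes s :: nat and h q :: complex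
  assumes "h \<noteq> 0" and "q \<noteq> 0"
  shows "(\<forall>n k :: nat. 1 \<le> n \<longrightarrow> 1 \<le> k \<longrightarrow>
           gen_stirling s h q n k =
             (\<Sum>r\<in>{k - 1..n - 1}. h ^ (n - r - 1) * q ^ r * gauss_binomial (q ^ s) (n - 1) r
               * gen_stirling s h q r (k - 1)
               * (\<Prod>i<n - r - 1. q_bracket q (1 + int s * int i)))) \<and>
         (\<forall>n :: nat. 1 \<le> n \<longrightarrow>
           gen_bell s h q n =
             (\<Sum>r\<in>{0..n - 1}. h ^ (n - r - 1) * q ^ r * gauss_binomial (q ^ s) (n - 1) r
               * gen_bell s h q r
               * (\<Prod>i<n - r - 1. q_bracket q (1 + int s * int i))))"
proof (intro conjI allI impI)
  fix n k :: nat
  assume "1 \<le> n" "1 \<le> k"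
  then obtain m j where n: "n = Suc m" and k: "k = Suc j"
    by (metis Suc_le_D One_nat_def)
  have "gen_stirling s h q n k = (\<Sum>r\<le>m. recurrence_weight s h q m r * gen_stirling s h q r j)"
    unfolding n k by (rule gen_stirling_Suc_Suc[OF \<open>q \<noteq> 0\<close>])
  \<comment> \<open>The terms with \<open>r < j\<close> vanish, which gives the lower limit
    \<open>k - 1\<close>.\<close>
  also have "\<dots> = (\<Sum>r\<in>{j..m}. recurrence_weight s h q m r * gen_stirling s h q r j)"
    by (intro sum.mono_neutral_right) (auto simp: gen_stirling_eq_0)
  finally show "gen_stirling s h q n k =
      (\<Sum>r\<in>{k - 1..n - 1}. h ^ (n - r - 1) * q ^ r * gauss_binomial (q ^ s) (n - 1) r
        * gen_stirling s h q r (k - 1) * (\<Prod>i<n - r - 1. q_bracket q (1 + int s * int i)))"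
    by (simp add: n k recurrence_weight_def ac_simps del: gen_stirling.simps)
next
  fix n :: nat
  assume "1 \<le> n"
  then obtain m where n: "n = Suc m"
    by (metis Suc_le_D One_nat_def)
  show "gen_bell s h q n =
      (\<Sum>r\<in>{0..n - 1}. h ^ (n - r - 1) * q ^ r * gauss_binomial (q ^ s) (n - 1) r
        * gen_bell s h q r * (\<Prod>i<n - r - 1. q_bracket q (1 + int s * int i)))"
    by (simp add: n gen_bell_Suc[OF \<open>q \<noteq> 0\<close>] recurrence_weight_def atLeast0AtMost ac_simps)
qed

end
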